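(* Let $H$ be a marked hypergraph with $|V(H)\setminus M(H)|\ge2$. For each $x\in V(H)\setminus M(H)$, let $\mathcal X_x$ be the collection of all dangers at $x$ in $H$. Then $H$ is a Breaker win if and only if for every $x\in V(H)\setminus M(H)$ we have $\mathrm{Int}_{H^{+x}}(\mathcal X_x)\neq\varnothing$.
   Context: A marked hypergraph $H$: finite nonempty $V(H)$, edge set $E(H)$ of nonempty subsets of $V(H)$, marked set $M(H)\subseteq V(H)$. Subhypergraph $X$: $V(X)\subseteq V(H)$, $E(X)\subseteq E(H)$, $M(X)=V(X)\cap M(H)$. $H^{+x}$ marks non-marked $x$; $H^{-y}$ deletes $y$ and all edges containing it. Trivial Maker win: some edge $e$ with $|e\setminus M(H)|\le1$. Maker win (recursive): if $|V(H)\setminus M(H)|\le1$, iff trivial Maker win; otherwise iff some non-marked $x$ has $H^{+x-y}$ a Maker win for all non-marked $y\ne x$; otherwise Breaker win. A danger at $x$ in $H$ is a subhypergraph $D$ of $H$ containing $x$ such that $D^{+x}$ is a Maker win. For a collection $\mathcal X$ of subhypergraphs, $\mathrm{Int}_{H^{+x}}(\mathcal X)$ is the set of vertices $y\in V(H)\setminus(M(H)\cup\{x\})$ with $y\in V(X)$ for all $X\in\mathcal X$. *)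

theory Defs
  imports Main
begin

record 'a hypergraph =
  verts :: "'a set"
  edges :: "'a set set"
  marks :: "'a set"

definition marked_hypergraph :: "'a hypergraph \<Rightarrow> bool" where
  "marked_hypergraph H \<longleftrightarrow>
     finite (verts H) \<and> verts H \<noteq> {} \<and>
     (\<forall>e\<in>edges H. e \<noteq> {} \<and> e \<subseteq> verts H) \<and>
     marks H \<subseteq> verts H"

abbreviation unmarked :: "'a hypergraph \<Rightarrow> 'a set" where
  "unmarked H \<equiv> verts H - marks H"

definition subhypergraph :: "'a hypergraph \<Rightarrow> 'a hypergraph \<Rightarrow> bool" where
  "subhypergraph X H \<longleftrightarrow>
     marked_hypergraph X \<and> verts X \<subseteq> verts H \<and> edges X \<subseteq> edges H \<and>
     marks X = verts X \<inter> marks H"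

definition mark :: "'a hypergraph \<Rightarrow> 'a \<Rightarrow> 'a hypergraph" where
  "mark H x = H\<lparr>marks := insert x (marks H)\<rparr>"

definition remove :: "'a hypergraph \<Rightarrow> 'a \<Rightarrow> 'a hypergraph" where
  "remove H y = \<lparr>verts = verts H - {y}, edges = {e \<in> edges H. y \<notin> e}, marks = marks H - {y}\<rparr>"

definition trivial_maker_win :: "'a hypergraph \<Rightarrow> bool" where
  "trivial_maker_win H \<longleftrightarrow> (\<exists>e\<in>edges H. card (e - marks H) \<le> 1)"

(* Total on all records: an infinite set of unmarked vertices has cardinality 0 and
   falls into the base case; this never occurs for a marked hypergraph. *)
function maker_win :: "'a hypergraph \<Rightarrow> bool" where
  "maker_win H \<longleftrightarrow>
     (if card (unmarked H) \<le> 1 then trivial_maker_win H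
      else \<exists>x\<in>unmarked H. \<forall>y\<in>unmarked H - {x}. maker_win (remove (mark H x) y))"
  by auto
termination
proof (relation "measure (\<lambda>H. card (unmarked H))", goal_cases)
  case 1
  show ?case by simp
next
  case (2 H x y)
  then have "finite (unmarked H)"
    by (metis card.infinite zero_le)
  moreover have "unmarked (remove (mark H x) y) \<subset> unmarked H"
    using 2 by (auto simp: remove_def mark_def)
  ultimately show ?case by (simp add: psubset_card_mono)
qed

declare maker_win.simps [simp del]

definition breaker_win :: "'a hypergraph \<Rightarrow> bool" where
  "breaker_win H \<longleftrightarrow> \<not> maker_win H"

definition danger :: "'a hypergraph \<Rightarrow> 'a \<Rightarrow> 'a hypergraph \<Rightarrow> bool" where
  "danger H x D \<longleftrightarrow> subhypergraph D H \<and> x \<in> verts D \<and> maker_win (mark D x)"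

(* Used below with G the hypergraph H with x marked, so that unmarked G = verts H - (marks H \<union> {x}). *)
definition Int_in :: "'a hypergraph \<Rightarrow> 'a hypergraph set \<Rightarrow> 'a set" where
  "Int_in G \<X> = {y \<in> unmarked G. \<forall>X\<in>\<X>. y \<in> verts X}"

end

theory Submission
  imports Defs
begin

text \<open>By the recursive definition, Breaker wins exactly when every first move \<open>x\<close>
  of Maker has a reply \<open>y\<close> such that H^{+x-y} is not a Maker win. So it suffices to
  show that the replies that fail are those missed by some danger at \<open>x\<close>
  (\<open>maker_win_remove_mark_iff_danger\<close>). If Maker wins H^{+x-y}, then H^{-y} is itself a
  danger at \<open>x\<close> that misses \<open>y\<close>. Conversely, if a danger D misses
  \<open>y\<close>, then D^{+x} survives intact inside H^{+x-y}, and a Maker win on a subhypergraph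
  is a Maker win on the whole (\<open>maker_win_mono\<close>). This monotonicity is the real
  content.\<close>

lemma marked_hypergraph_mark:
  "marked_hypergraph H \<Longrightarrow> x \<in> verts H \<Longrightarrow> marked_hypergraph (mark H x)"
  by (auto simp: marked_hypergraph_def mark_def)

text \<open>The second vertex \<open>x\<close> witnesses that the vertex set stays nonempty after
  \<open>y\<close> is deleted.\<close>

lemma marked_hypergraph_remove:
  "marked_hypergraph H \<Longrightarrow> x \<in> verts H \<Longrightarrow> x \<noteq> y \<Longrightarrow> marked_hypergraph (remove H y)"
  by (auto simp: marked_hypergraph_def remove_def)

lemma verts_mark [simp]: "verts (mark H x) = verts H"
  by (simp add: mark_def)

lemma mark_remove: "x \<noteq> y \<Longrightarrow> mark (remove H y) x = remove (mark H x) y"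
  by (auto simp: mark_def remove_def)

lemma maker_win_iff:
  assumes "card (unmarked H) \<ge> 2"
  shows "maker_win H \<longleftrightarrow> (\<exists>x\<in>unmarked H. \<forall>y\<in>unmarked H - {x}. maker_win (remove (mark H x) y))"
  using assms by (subst maker_win.simps) simp

lemma maker_win_iff_trivial:
  assumes "card (unmarked H) \<le> 1"
  shows "maker_win H \<longleftrightarrow> trivial_maker_win H"
  using assms by (subst maker_win.simps) simp

text \<open>Maker marks the last unmarked vertex of the edge, if there is one. The edge is then
  fully marked, so Breaker, who deletes an unmarked vertex, cannot destroy it, and the trivial win
  persists down to the base case of the recursion.\<close>

lemma trivial_maker_win_imp_maker_win:
  assumes "marked_hypergraph H" "trivial_maker_win H"
  shows "maker_win H"
  using assms
proof (induction H rule: maker_win.induct)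
  case (1 H)
  show ?case
  proof (cases "card (unmarked H) \<le> 1")
    case True
    then show ?thesis using 1(3) by (simp add: maker_win_iff_trivial)
  next
    case False
    from 1(3) obtain e where e: "e \<in> edges H" "card (e - marks H) \<le> 1"
      by (auto simp: trivial_maker_win_def)
    have sub: "e \<subseteq> verts H"
      using 1(2) e(1) by (auto simp: marked_hypergraph_def)
    then have fin: "finite e"
      using 1(2) by (metis marked_hypergraph_def finite_subset)
    have "unmarked H \<noteq> {}" using False by (metis card.empty zero_le)
    \<comment> \<open>If the edge is already fully marked, any unmarked vertex is a suitable
      move.\<close>
    then obtain x where x: "x \<in> unmarked H" "e - marks H \<subseteq> {x}"
    proof (cases "e - marks H = {}")
      case True
      then show ?thesis using that \<open>unmarked H \<noteq> {}\<close> by auto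
    next
      case nonempty: False
      then have "card (e - marks H) = 1"
        using e(2) fin by (metis One_nat_def card_0_eq finite_Diff le_Suc_eq le_zero_eq)
      then obtain x where "e - marks H = {x}" by (auto simp: card_1_singleton_iff)
      then show ?thesis using that sub by blast
    qed
    have "maker_win (remove (mark H x) y)" if y: "y \<in> unmarked H - {x}" for y
    proof (rule 1(1)[OF False x(1) y])
      show "marked_hypergraph (remove (mark H x) y)"
        using 1(2) x(1) y by (auto intro!: marked_hypergraph_remove[where x = x] marked_hypergraph_mark)
      have "y \<notin> e" using x y by auto
      have "e - (insert x (marks H) - {y}) = {}" using x y \<open>y \<notin> e\<close> by auto
      then have "card (e - (insert x (marks H) - {y})) = 0" by (simp only: card.empty)
      with \<open>y \<notin> e\<close> show "trivial_maker_win (remove (mark H x) y)"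
        using e(1) unfolding trivial_maker_win_def
        by (intro bexI[of _ e]) (simp_all add: remove_def mark_def)
    qed
    then show ?thesis using x(1) False by (subst maker_win_iff) auto
  qed
qed

lemma trivial_maker_win_mono:
  assumes "subhypergraph X H" "trivial_maker_win X"
  shows "trivial_maker_win H"
proof -
  obtain e where e: "e \<in> edges X" "card (e - marks X) \<le> 1"
    using assms(2) by (auto simp: trivial_maker_win_def)
  \<comment> \<open>The edge lies inside \<open>verts X\<close>, where the marks of \<open>X\<close>
    and \<open>H\<close> agree.\<close>
  have "e - marks X = e - marks H"
    using e assms(1) by (auto simp: subhypergraph_def marked_hypergraph_def)
  then show ?thesis using e assms(1) by (auto simp: trivial_maker_win_def subhypergraph_def)
qed

lemma subhypergraph_mark:
  assumes "subhypergraph X H" "x \<in> verts X"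
  shows "subhypergraph (mark X x) (mark H x)"
  using assms by (auto simp: subhypergraph_def marked_hypergraph_def mark_def)

lemma subhypergraph_remove:
  assumes "subhypergraph X H" "x \<in> verts X" "x \<noteq> y"
  shows "subhypergraph (remove X y) (remove H y)"
  using assms by (auto simp: subhypergraph_def marked_hypergraph_def remove_def)

lemma subhypergraph_remove_outside:
  assumes "subhypergraph X H" "y \<notin> verts X"
  shows "subhypergraph X (remove H y)"
  using assms by (auto simp: subhypergraph_def marked_hypergraph_def remove_def)

lemma subhypergraph_trans:
  "subhypergraph X Y \<Longrightarrow> subhypergraph Y Z \<Longrightarrow> subhypergraph X Z"
  by (auto simp: subhypergraph_def)

lemma remove_subhypergraph:
  assumes "marked_hypergraph H" "x \<in> verts H" "x \<noteq> y"
  shows "subhypergraph (remove H y) H"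
  using assms by (auto simp: subhypergraph_def marked_hypergraph_def remove_def)

text \<open>Maker opens in \<open>H\<close> with her winning move in \<open>X\<close>. The induction
  follows the recursion on \<open>H\<close> and keeps \<open>X\<close> arbitrary, because after
  Breaker's reply the smaller hypergraph may have lost a different vertex than \<open>H\<close>
  has.\<close>

lemma maker_win_mono:
  assumes "marked_hypergraph H" "subhypergraph X H" "maker_win X"
  shows "maker_win H"
  using assms
proof (induction H arbitrary: X rule: maker_win.induct)
  case (1 H)
  have finH: "finite (unmarked H)" and unm: "unmarked X \<subseteq> unmarked H"
    using 1(2,3) by (auto simp: marked_hypergraph_def subhypergraph_def)
  show ?case
  proof (cases "card (unmarked X) \<le> 1")
    case True
    then have "trivial_maker_win X" using 1(4) by (simp add: maker_win_iff_trivial)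
    \<comment> \<open>The recursion for \<open>X\<close> has bottomed out, but \<open>H\<close> may
      still have many unmarked vertices; the trivial win is lifted to \<open>H\<close> and then
      played out there.\<close>
    then show ?thesis
      using 1(2,3) trivial_maker_win_mono trivial_maker_win_imp_maker_win by blast
  next
    case False
    then have H: "\<not> card (unmarked H) \<le> 1"
      using card_mono[OF finH unm] by linarith
    obtain x where x: "x \<in> unmarked X"
      and win: "\<And>y. y \<in> unmarked X - {x} \<Longrightarrow> maker_win (remove (mark X x) y)"
      using 1(4) False maker_win_iff[of X] by auto
    have xH: "x \<in> unmarked H" using x unm by blast
    have sub: "subhypergraph (mark X x) (mark H x)"
      using 1(3) x by (simp add: subhypergraph_mark)
    have "maker_win (remove (mark H x) y)" if y: "y \<in> unmarked H - {x}" for y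
    proof -
      have marked: "marked_hypergraph (remove (mark H x) y)"
        using 1(2) xH y by (auto intro!: marked_hypergraph_remove[where x = x] marked_hypergraph_mark)
      show ?thesis
      proof (cases "y \<in> verts X")
        case True
        then have "y \<in> unmarked X - {x}" using y 1(3) by (auto simp: subhypergraph_def)
        moreover have "subhypergraph (remove (mark X x) y) (remove (mark H x) y)"
          using sub x y by (intro subhypergraph_remove[where x = x]) auto
        ultimately show ?thesis using 1(1)[OF H xH y marked] win by blast
      next
        \<comment> \<open>Breaker deletes a vertex outside \<open>X\<close>; Maker pretends that he deleted some \<open>z\<close> in \<open>X\<close>.\<close>
        case outside: False
        have "unmarked X - {x} \<noteq> {}"
        proof
          assume "unmarked X - {x} = {}"
          then have "unmarked X = {x}" using x by blast
          then show False using False by simp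
        qed
        then obtain z where z: "z \<in> unmarked X - {x}" by blast
        have "marked_hypergraph (mark X x)" using sub by (simp add: subhypergraph_def)
        \<comment> \<open>Only after a deletion is the position in \<open>X\<close> known to be a
          Maker win. It embeds in \<open>mark X x\<close>, which the deletion of \<open>y\<close>
          leaves untouched.\<close>
        then have "subhypergraph (remove (mark X x) z) (mark X x)"
          using x z by (intro remove_subhypergraph[where x = x]) auto
        moreover have "subhypergraph (mark X x) (remove (mark H x) y)"
          using sub outside by (intro subhypergraph_remove_outside) auto
        ultimately show ?thesis
          using 1(1)[OF H xH y marked] win[OF z] subhypergraph_trans by blast
      qed
    qed
    then show ?thesis using xH H by (subst maker_win_iff) auto
  qed
qed

text \<open>This turns the game condition on Breaker's reply \<open>y\<close> into a condition on
  dangers. The largest candidate for a danger missing \<open>y\<close> is \<open>remove H y\<close>,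
  which serves as the witness.\<close>

lemma maker_win_remove_mark_iff_danger:
  assumes "marked_hypergraph H" "x \<in> verts H" "x \<noteq> y"
  shows "maker_win (remove (mark H x) y) \<longleftrightarrow> (\<exists>D. danger H x D \<and> y \<notin> verts D)"
proof
  assume "maker_win (remove (mark H x) y)"
  then have "danger H x (remove H y)"
    using assms remove_subhypergraph[OF assms]
    by (simp add: danger_def mark_remove) (simp add: remove_def)
  then show "\<exists>D. danger H x D \<and> y \<notin> verts D" by (auto simp: remove_def)
next
  assume "\<exists>D. danger H x D \<and> y \<notin> verts D"
  then obtain D where D: "subhypergraph D H" "x \<in> verts D" "maker_win (mark D x)" "y \<notin> verts D"
    by (auto simp: danger_def)
  have "subhypergraph (mark D x) (remove (mark H x) y)"
    using D by (intro subhypergraph_remove_outside subhypergraph_mark) auto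
  moreover have "marked_hypergraph (remove (mark H x) y)"
    using assms by (auto intro!: marked_hypergraph_remove[where x = x] marked_hypergraph_mark)
  ultimately show "maker_win (remove (mark H x) y)" using D(3) maker_win_mono by blast
qed

theorem mainTheorem9:
  fixes H :: "'a hypergraph"
  assumes "marked_hypergraph H" and "card (unmarked H) \<ge> 2"
  shows "breaker_win H \<longleftrightarrow>
    (\<forall>x\<in>unmarked H. Int_in (mark H x) {D. danger H x D} \<noteq> {})"
proof -
  \<comment> \<open>The intersection is thus exactly the set of Breaker's good replies to
    \<open>x\<close>, and the theorem is the negated recursion step.\<close>
  have "Int_in (mark H x) {D. danger H x D}
      = {y \<in> unmarked H - {x}. \<not> maker_win (remove (mark H x) y)}" if "x \<in> unmarked H" for x
    using that maker_win_remove_mark_iff_danger[OF assms(1), of x]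
    by (auto simp: Int_in_def mark_def)
  then show ?thesis
    using maker_win_iff[OF assms(2)] by (auto simp: breaker_win_def)
qed

end
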